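(* For $n\geq1$, we have $$\sum_{T\in\mathcal{P}_n} x^{\mathsf{oleaf}(T)}y^{\mathsf{yleaf}(T)}=\sum_{T\in\mathcal{P}_n} x^{\mathsf{elint}(T)}y^{\mathsf{elleaf}(T)}.$$
   Context: A plane tree is a rooted tree in which the children of each node are linearly ordered (from left to right); $\mathcal{P}_n$ is the set of plane trees with $n$ edges. A leaf is a node without children; an internal node is a node with at least one child. A leaf is old if it is the leftmost child of its parent (including the case that it is the only child), and young otherwise; $\mathsf{oleaf}(T)$ and $\mathsf{yleaf}(T)$ are the numbers of old and young leaves of $T$. The level of a node is the number of edges on the path from the root to it; $\mathsf{elint}(T)$ is the number of internal nodes in even levels of $T$ and $\mathsf{elleaf}(T)$ is the number of leaves in even levels of $T$. *)

theory Defs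
  imports Main
begin

datatype plane_tree = Node (children: "plane_tree list")

text \<open>
  A node is addressed by the path leading to it from the root \<open>[]\<close>: the children of
  the node \<open>p\<close> are, from left to right, \<open>p @ [0]\<close>, \<open>p @ [1]\<close>, and so on.
  Hence the level of a node is the length of its address.
\<close>

lemma size_nth_less [termination_simp]:
  "i < length ts \<Longrightarrow> size (ts ! i) < Suc (size_list size ts)"
  by (metis nth_mem le_imp_less_Suc order_refl size_list_estimation')

fun nodes :: "plane_tree \<Rightarrow> nat list set" where
  "nodes (Node ts) = insert [] (\<Union>i<length ts. (#) i ` nodes (ts ! i))"

definition edges :: "plane_tree \<Rightarrow> (nat list \<times> nat list) set" where
  "edges T = {(p, q). p \<in> nodes T \<and> q \<in> nodes T \<and> (\<exists>i. q = p @ [i])}"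

definition plane_trees :: "nat \<Rightarrow> plane_tree set" where
  "plane_trees n = {T. card (edges T) = n}"

definition leaves :: "plane_tree \<Rightarrow> nat list set" where
  "leaves T = {p \<in> nodes T. \<not> (\<exists>i. p @ [i] \<in> nodes T)}"

definition internal_nodes :: "plane_tree \<Rightarrow> nat list set" where
  "internal_nodes T = {p \<in> nodes T. \<exists>i. p @ [i] \<in> nodes T}"

definition level :: "nat list \<Rightarrow> nat" where
  "level p = length p"

definition old_leaves :: "plane_tree \<Rightarrow> nat list set" where
  "old_leaves T = {p \<in> leaves T. \<exists>q. p = q @ [0]}"

definition young_leaves :: "plane_tree \<Rightarrow> nat list set" where
  "young_leaves T = leaves T - old_leaves T"

definition oleaf :: "plane_tree \<Rightarrow> nat" where
  "oleaf T = card (old_leaves T)"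

definition yleaf :: "plane_tree \<Rightarrow> nat" where
  "yleaf T = card (young_leaves T)"

definition elint :: "plane_tree \<Rightarrow> nat" where
  "elint T = card {p \<in> internal_nodes T. even (level p)}"

definition elleaf :: "plane_tree \<Rightarrow> nat" where
  "elleaf T = card {p \<in> leaves T. even (level p)}"

text \<open>
  All the sets counted or summed over are finite, so no \<^const>\<open>card\<close> or \<^const>\<open>sum\<close>
  takes its default value \<open>0\<close>.
\<close>

lemma finite_nodes: "finite (nodes T)"
  by (induction T rule: nodes.induct) auto

lemma Nil_in_nodes: "[] \<in> nodes T"
  by (cases T) auto

lemma butlast_in_nodes: "p @ [i] \<in> nodes T \<Longrightarrow> p \<in> nodes T"
proof (induction p arbitrary: T)
  case Nil
  show ?case by (rule Nil_in_nodes)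
next
  case (Cons j p)
  obtain ts where "T = Node ts" by (cases T)
  with Cons show ?case by auto
qed

lemma card_edges: "Suc (card (edges T)) = card (nodes T)"
proof -
  have "edges T = (\<lambda>q. (butlast q, q)) ` (nodes T - {[]})" (is "_ = ?f ` _")
  proof (intro equalityI subsetI)
    fix e assume "e \<in> edges T"
    then obtain p i where "e = (p, p @ [i])" "p @ [i] \<in> nodes T" by (auto simp: edges_def)
    then show "e \<in> ?f ` (nodes T - {[]})" by (intro image_eqI[where x = "p @ [i]"]) auto
  next
    fix e assume "e \<in> ?f ` (nodes T - {[]})"
    then obtain q where q: "q \<in> nodes T" "q \<noteq> []" "e = (butlast q, q)" by auto
    then obtain p i where "q = p @ [i]" by (metis append_butlast_last_id)
    with q show "e \<in> edges T" by (auto simp: edges_def dest: butlast_in_nodes)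
  qed
  moreover have "inj_on ?f (nodes T - {[]})" by (auto simp: inj_on_def)
  ultimately have "card (edges T) = card (nodes T - {[]})" by (simp add: card_image)
  then show ?thesis
    using card.remove[OF finite_nodes Nil_in_nodes] by metis
qed

lemma card_nodes_Node: "card (nodes (Node ts)) = Suc (\<Sum>i<length ts. card (nodes (ts ! i)))"
proof -
  have "card (\<Union>i<length ts. (#) i ` nodes (ts ! i)) = (\<Sum>i<length ts. card ((#) i ` nodes (ts ! i)))"
    by (rule card_UN_disjoint) (auto simp: finite_nodes)
  also have "\<dots> = (\<Sum>i<length ts. card (nodes (ts ! i)))"
    by (intro sum.cong card_image) auto
  finally show ?thesis
    by (subst nodes.simps, subst card_insert_disjoint) (auto simp: finite_nodes)
qed

lemma finite_card_nodes_le: "finite {T. card (nodes T) \<le> n}"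
proof (induction n)
  case 0
  have "card (nodes T) \<noteq> 0" for T
    using finite_nodes Nil_in_nodes by (metis card_0_eq empty_iff)
  then have "{T. card (nodes T) \<le> 0} = {}" by blast
  then show ?case by (simp only: finite.emptyI)
next
  case (Suc n)
  let ?A = "{T. card (nodes T) \<le> n}"
  have "T \<in> Node ` {ts. set ts \<subseteq> ?A \<and> length ts \<le> n}" if T: "card (nodes T) \<le> Suc n" for T
  proof -
    obtain ts where ts: "T = Node ts" by (cases T)
    have le: "(\<Sum>i<length ts. card (nodes (ts ! i))) \<le> n"
      using T by (simp add: ts card_nodes_Node del: nodes.simps)
    have "card (nodes t) \<ge> 1" for t
      using card_edges[of t] by linarith
    then have "(\<Sum>i<length ts. 1) \<le> (\<Sum>i<length ts. card (nodes (ts ! i)))"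
      by (intro sum_mono) auto
    with le have "length ts \<le> n" by simp
    moreover have "card (nodes (ts ! i)) \<le> n" if "i < length ts" for i
    proof -
      have "card (nodes (ts ! i)) \<le> (\<Sum>i<length ts. card (nodes (ts ! i)))"
        using that by (intro member_le_sum[where f = "\<lambda>i. card (nodes (ts ! i))"]) auto
      with le show ?thesis by linarith
    qed
    ultimately have "ts \<in> {ts. set ts \<subseteq> ?A \<and> length ts \<le> n}" by (auto simp: in_set_conv_nth)
    then show ?thesis unfolding ts by (rule imageI)
  qed
  then have "{T. card (nodes T) \<le> Suc n} \<subseteq> Node ` {ts. set ts \<subseteq> ?A \<and> length ts \<le> n}" by blast
  moreover have "finite {ts. set ts \<subseteq> ?A \<and> length ts \<le> n}"
    by (rule finite_lists_length_le[OF Suc.IH])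
  ultimately show ?case by (meson finite_imageI finite_subset)
qed

lemma finite_plane_trees: "finite (plane_trees n)"
proof (rule finite_subset)
  show "plane_trees n \<subseteq> {T. card (nodes T) \<le> Suc n}"
    by (auto simp: plane_trees_def card_edges[symmetric])
qed (rule finite_card_nodes_le)

end

theory Submission
  imports Defs
begin

text \<open>
  Both pairs of statistics obey the same recursion.  Let \<open>F\<close> and \<open>G\<close> be the generating
  functions, with \<open>z\<close> marking edges, of the two sides over the trees with at least one edge.

  For old and young leaves, look at the last child of the root.  It is the only child or not, and
  it is a leaf or the root of a tree with at least one edge.  Deleting one of several children
  from the right changes neither the order of the others nor the leaves below them, and a last
  child that is a leaf is old exactly if it is the only child.  The four cases give
  \<open>F = zx + zF + zyF + zF\<^sup>2\<close>.

  For even levels, look at the first child of the root, which is at level 1.  If it is a leaf, it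
  is the only child (\<open>zx\<close>, the root being internal) or can be deleted (\<open>zG\<close>).  Otherwise cut off
  its first child, which is at level 2, so that the subtree below it keeps its parities: it is
  a leaf (\<open>zyG\<close>) or a tree with at least one edge (\<open>zG\<^sup>2\<close>).

  Hence \<open>F\<close> and \<open>G\<close> satisfy the same equation.  Bijectively, trees of both kinds are built in the
  same way from unary-binary trees whose unary nodes have one of two colours.
  The functions \<open>last_child_tree\<close> and \<open>first_child_tree\<close> are these two constructions; both are
  bijections onto the trees with at least one edge, and the same statistics of the coloured
  unary-binary tree account for the edges and for both pairs of tree statistics.
\<close>

datatype motzkin = Tip | Red motzkin | Blue motzkin | Fork motzkin motzkin

primrec vertices :: "motzkin \<Rightarrow> nat" where
  "vertices Tip = 1"
| "vertices (Red m) = Suc (vertices m)"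
| "vertices (Blue m) = Suc (vertices m)"
| "vertices (Fork m m') = Suc (vertices m + vertices m')"

primrec tips :: "motzkin \<Rightarrow> nat" where
  "tips Tip = 1"
| "tips (Red m) = tips m"
| "tips (Blue m) = tips m"
| "tips (Fork m m') = tips m + tips m'"

primrec blues :: "motzkin \<Rightarrow> nat" where
  "blues Tip = 0"
| "blues (Red m) = blues m"
| "blues (Blue m) = Suc (blues m)"
| "blues (Fork m m') = blues m + blues m'"

section \<open>Recursive equations for the statistics\<close>

text \<open>
  Splitting addresses by their first entry turns the cardinality of a set of nodes into a sum over
  the subtrees of the root; all recursive equations below are instances.
\<close>

lemma card_addresses:
  assumes "finite S" and "\<And>i p. i # p \<in> S \<longleftrightarrow> i < length ts \<and> p \<in> A i (ts ! i)"
  shows "card S = of_bool ([] \<in> S) + (\<Sum>i<length ts. card (A i (ts ! i)))"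
proof -
  let ?U = "\<Union>i<length ts. (#) i ` A i (ts ! i)"
  have S: "S = (if [] \<in> S then insert [] ?U else ?U)"
  proof (intro set_eqI)
    fix p show "p \<in> S \<longleftrightarrow> p \<in> (if [] \<in> S then insert [] ?U else ?U)"
      using assms(2) by (cases p) auto
  qed
  have "?U \<subseteq> S"
    using assms(2) by auto
  then have fin: "finite ?U"
    using assms(1) by (rule finite_subset)
  have fin': "finite (A i (ts ! i))" if "i < length ts" for i
  proof -
    have "(#) i ` A i (ts ! i) \<subseteq> ?U" using that by blast
    then have "finite ((#) i ` A i (ts ! i))" using fin finite_subset by blast
    then show ?thesis by (rule finite_imageD) simp
  qed
  have "card ?U = (\<Sum>i<length ts. card ((#) i ` A i (ts ! i)))"
    by (rule card_UN_disjoint) (use fin' in auto)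
  also have "\<dots> = (\<Sum>i<length ts. card (A i (ts ! i)))"
    by (intro sum.cong card_image) auto
  finally have U: "card ?U = (\<Sum>i<length ts. card (A i (ts ! i)))" .
  show ?thesis
  proof (cases "[] \<in> S")
    case True
    then have "S = insert [] ?U" using S by argo
    moreover have "card (insert [] ?U) = Suc (card ?U)"
      by (rule card_insert_disjoint[OF fin]) auto
    ultimately have "card S = Suc (card ?U)" by argo
    with True U show ?thesis by simp
  next
    case False
    then have "S = ?U" using S by argo
    with False U show ?thesis by simp
  qed
qed

lemma sum_nth_eq_sum_list: "(\<Sum>i<length ts. f (ts ! i)) = sum_list (map f ts)"
  by (simp add: sum_list_sum_nth atLeast0LessThan)

lemma card_addresses_uniform:
  assumes "finite S" and "\<And>i p. i # p \<in> S \<longleftrightarrow> i < length ts \<and> p \<in> A (ts ! i)"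
  shows "card S = of_bool ([] \<in> S) + sum_list (map (\<lambda>t. card (A t)) ts)"
  using card_addresses[of S ts "\<lambda>_. A"] assms
  by (simp add: sum_nth_eq_sum_list[of "\<lambda>t. card (A t)"])

lemma singleton_in_nodes: "[i] \<in> nodes (Node ts) \<longleftrightarrow> i < length ts"
  using Nil_in_nodes by (auto simp: image_iff)

lemma Nil_in_leaves: "[] \<in> leaves (Node ts) \<longleftrightarrow> ts = []"
  by (simp add: leaves_def Nil_in_nodes singleton_in_nodes del: nodes.simps) auto

lemma Cons_in_leaves: "i # p \<in> leaves (Node ts) \<longleftrightarrow> i < length ts \<and> p \<in> leaves (ts ! i)"
  by (auto simp: leaves_def)

lemma Nil_in_internal_nodes: "[] \<in> internal_nodes (Node ts) \<longleftrightarrow> ts \<noteq> []"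
  by (simp add: internal_nodes_def Nil_in_nodes singleton_in_nodes del: nodes.simps) auto

lemma Cons_in_internal_nodes:
  "i # p \<in> internal_nodes (Node ts) \<longleftrightarrow> i < length ts \<and> p \<in> internal_nodes (ts ! i)"
  by (auto simp: internal_nodes_def)

lemma finite_leaves: "finite (leaves T)"
  using finite_nodes[of T] by (simp add: leaves_def)

lemma finite_internal_nodes: "finite (internal_nodes T)"
  using finite_nodes[of T] by (simp add: internal_nodes_def)

lemma card_edges_Node: "card (edges (Node ts)) = sum_list (map (\<lambda>t. Suc (card (edges t))) ts)"
  using card_nodes_Node[of ts] unfolding card_edges[symmetric]
  by (simp add: sum_nth_eq_sum_list[of "\<lambda>t. Suc (card (edges t))"])

lemma Cons_in_old_leaves:
  "i # p \<in> old_leaves (Node ts) \<longleftrightarrow>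
   i < length ts \<and> (p \<in> old_leaves (ts ! i) \<or> p = [] \<and> i = 0 \<and> ts ! i = Node [])"
proof (cases p)
  case Nil
  have "[] \<in> leaves t \<longleftrightarrow> t = Node []" for t
    by (cases t) (simp add: Nil_in_leaves)
  with Nil show ?thesis
    by (auto simp: old_leaves_def Cons_in_leaves)
next
  case (Cons j p')
  then have "(\<exists>q. i # p = q @ [0]) \<longleftrightarrow> (\<exists>q. p = q @ [0])"
    by (auto simp: Cons_eq_append_conv)
  with Cons show ?thesis
    unfolding old_leaves_def mem_Collect_eq Cons_in_leaves by blast
qed

text \<open>
  The leaf of a one-node tree has no parent, so it is young.  It turns old when the tree becomes the
  first child of a root, and then has to be counted separately.
\<close>

lemma oleaf_Node:
  "oleaf (Node []) = 0"
  "oleaf (Node (t # ts)) = (if t = Node [] then 1 else oleaf t) + sum_list (map oleaf ts)"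
proof -
  show "oleaf (Node []) = 0"
    by (simp add: oleaf_def old_leaves_def leaves_def)
  \<comment> \<open>\<open>A i t'\<close> collects the addresses within \<open>t'\<close> of the leaves that are old in the whole tree
    when \<open>t'\<close> is its child number \<open>i\<close>.\<close>
  define A where "A i t' = old_leaves t' \<union> (if i = 0 \<and> t' = Node [] then {[]} else {})" for i :: nat and t'
  have fin: "finite (old_leaves T)" for T
    using finite_leaves[of T] by (simp add: old_leaves_def)
  have "oleaf (Node (t # ts)) = of_bool ([] \<in> old_leaves (Node (t # ts)))
      + (\<Sum>i<length (t # ts). card (A i ((t # ts) ! i)))"
    unfolding oleaf_def
  proof (rule card_addresses[OF fin])
    fix i p
    show "i # p \<in> old_leaves (Node (t # ts)) \<longleftrightarrow>
        i < length (t # ts) \<and> p \<in> A i ((t # ts) ! i)"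
      unfolding Cons_in_old_leaves by (auto simp: A_def)
  qed
  also have "\<dots> = card (A 0 t) + (\<Sum>i<length ts. card (A (Suc i) (ts ! i)))"
    by (simp add: sum.lessThan_Suc_shift old_leaves_def del: sum.lessThan_Suc)
  also have "card (A 0 t) = (if t = Node [] then 1 else oleaf t)"
    by (auto simp: A_def oleaf_def old_leaves_def leaves_def)
  also have "(\<Sum>i<length ts. card (A (Suc i) (ts ! i))) = sum_list (map oleaf ts)"
    by (simp add: A_def oleaf_def flip: sum_nth_eq_sum_list)
  finally show "oleaf (Node (t # ts)) = (if t = Node [] then 1 else oleaf t) + sum_list (map oleaf ts)" .
qed

lemma card_leaves_Node:
  "card (leaves (Node ts)) = (if ts = [] then 1 else sum_list (map (\<lambda>t. card (leaves t)) ts))"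
  using card_addresses_uniform[of "leaves (Node ts)" ts leaves]
  by (auto simp: finite_leaves Nil_in_leaves Cons_in_leaves)

lemma oleaf_plus_yleaf: "oleaf T + yleaf T = card (leaves T)"
proof -
  have "old_leaves T \<subseteq> leaves T" by (auto simp: old_leaves_def)
  then show ?thesis
    using finite_leaves[of T]
    by (simp add: oleaf_def yleaf_def young_leaves_def card_Diff_subset finite_subset card_mono)
qed

lemma yleaf_Node:
  "yleaf (Node []) = 1"
  "yleaf (Node (t # ts)) = (if t = Node [] then 0 else yleaf t) + sum_list (map yleaf ts)"
proof -
  show "yleaf (Node []) = 1"
    using oleaf_plus_yleaf[of "Node []"] by (simp add: oleaf_Node card_leaves_Node)
  have "sum_list (map (\<lambda>t. card (leaves t)) ts) = sum_list (map oleaf ts) + sum_list (map yleaf ts)"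
    by (simp add: sum_list_addf flip: oleaf_plus_yleaf)
  then show "yleaf (Node (t # ts)) = (if t = Node [] then 0 else yleaf t) + sum_list (map yleaf ts)"
    using oleaf_plus_yleaf[of "Node (t # ts)"] oleaf_plus_yleaf[of t]
    by (auto simp: oleaf_Node card_leaves_Node)
qed

text \<open>
  Passing to a subtree of the root shifts levels by one, so the even-level statistics recur through
  their odd-level counterparts.
\<close>

definition olint :: "plane_tree \<Rightarrow> nat" where
  "olint T = card {p \<in> internal_nodes T. odd (level p)}"

definition olleaf :: "plane_tree \<Rightarrow> nat" where
  "olleaf T = card {p \<in> leaves T. odd (level p)}"

lemma elint_Node: "elint (Node ts) = of_bool (ts \<noteq> []) + sum_list (map olint ts)"
  unfolding elint_def olint_def
  by (subst card_addresses_uniform[where A = "\<lambda>t. {p \<in> internal_nodes t. odd (level p)}"])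
    (auto simp: finite_internal_nodes Nil_in_internal_nodes Cons_in_internal_nodes level_def)

lemma olint_Node: "olint (Node ts) = sum_list (map elint ts)"
  unfolding elint_def olint_def
  by (subst card_addresses_uniform[where A = "\<lambda>t. {p \<in> internal_nodes t. even (level p)}"])
    (auto simp: finite_internal_nodes Cons_in_internal_nodes level_def)

lemma elleaf_Node: "elleaf (Node ts) = of_bool (ts = []) + sum_list (map olleaf ts)"
  unfolding elleaf_def olleaf_def
  by (subst card_addresses_uniform[where A = "\<lambda>t. {p \<in> leaves t. odd (level p)}"])
    (auto simp: finite_leaves Nil_in_leaves Cons_in_leaves level_def)

lemma olleaf_Node: "olleaf (Node ts) = sum_list (map elleaf ts)"
  unfolding elleaf_def olleaf_def
  by (subst card_addresses_uniform[where A = "\<lambda>t. {p \<in> leaves t. even (level p)}"])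
    (auto simp: finite_leaves Cons_in_leaves level_def)

section \<open>Decomposition at the last child\<close>

text \<open>
  The last child of the root is a leaf for \<open>Tip\<close> and \<open>Blue\<close>, and it is the only child for \<open>Tip\<close>
  and \<open>Red\<close>.
\<close>

primrec last_child_tree :: "motzkin \<Rightarrow> plane_tree" where
  "last_child_tree Tip = Node [Node []]"
| "last_child_tree (Red m) = Node [last_child_tree m]"
| "last_child_tree (Blue m) = Node (children (last_child_tree m) @ [Node []])"
| "last_child_tree (Fork m m') = Node (children (last_child_tree m) @ [last_child_tree m'])"

lemma children_last_child_tree: "children (last_child_tree m) \<noteq> []"
  by (cases m) auto

lemma last_child_tree_not_leaf: "last_child_tree m \<noteq> Node []"
  using children_last_child_tree[of m] by auto

lemmas last_child_tree_neqs =
  last_child_tree_not_leaf children_last_child_tree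
  last_child_tree_not_leaf[symmetric] children_last_child_tree[symmetric]

lemma inj_last_child_tree: "inj last_child_tree"
proof (rule injI)
  have children_inj: "children T = children T' \<Longrightarrow> T = T'" for T T'
    by (cases T; cases T') auto
  fix m m' show "last_child_tree m = last_child_tree m' \<Longrightarrow> m = m'"
  proof (induction m arbitrary: m')
    case Tip
    then show ?case by (cases m') (auto simp: last_child_tree_neqs)
  next
    case (Red m)
    then show ?case by (cases m') (auto simp: last_child_tree_neqs)
  next
    case (Blue m)
    then show ?case by (cases m') (auto simp: last_child_tree_neqs intro: children_inj)
  next
    case (Fork m1 m2)
    then show ?case by (cases m') (auto simp: last_child_tree_neqs intro: children_inj)
  qed
qed

lemma range_last_child_tree: "T \<noteq> Node [] \<Longrightarrow> T \<in> range last_child_tree"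
proof (induction "size T" arbitrary: T rule: less_induct)
  case less
  obtain ts t where T: "T = Node (ts @ [t])"
    using less.prems by (metis plane_tree.exhaust rev_exhaust)
  have t: "t \<in> range last_child_tree" if "t \<noteq> Node []"
    using less.hyps[of t] that by (simp add: T)
  have ts: "Node ts \<in> range last_child_tree" if "ts \<noteq> []"
    using less.hyps[of "Node ts"] that by (simp add: T)
  show ?case
  proof (cases "ts = []"; cases "t = Node []")
    assume "ts = []" "t = Node []"
    then have "T = last_child_tree Tip" by (simp add: T)
    then show ?thesis by blast
  next
    assume "ts = []" "t \<noteq> Node []"
    with t obtain m where "t = last_child_tree m" by blast
    with \<open>ts = []\<close> have "T = last_child_tree (Red m)" by (simp add: T)
    then show ?thesis by blast
  next
    assume "ts \<noteq> []" "t = Node []"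
    with ts obtain m where "last_child_tree m = Node ts" by (metis imageE)
    with \<open>t = Node []\<close> have "T = last_child_tree (Blue m)" by (simp add: T)
    then show ?thesis by blast
  next
    assume "ts \<noteq> []" "t \<noteq> Node []"
    with ts t obtain m m' where "last_child_tree m = Node ts" "last_child_tree m' = t"
      by (metis imageE)
    then have "T = last_child_tree (Fork m m')" by (simp add: T)
    then show ?thesis by blast
  qed
qed

text \<open>
  Since the root already has a child, the new last child is not leftmost.  If it is a leaf, it is
  young, as it is when it forms a tree by itself; this is why the leaf counts are simply additive.
\<close>

lemma snoc_child:
  assumes "children T \<noteq> []"
  shows "card (edges (Node (children T @ [t]))) = card (edges T) + Suc (card (edges t))"
    and "oleaf (Node (children T @ [t])) = oleaf T + oleaf t"
    and "yleaf (Node (children T @ [t])) = yleaf T + yleaf t"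
proof -
  obtain u us where T: "T = Node (u # us)"
    using assms by (metis plane_tree.collapse list.exhaust)
  show "card (edges (Node (children T @ [t]))) = card (edges T) + Suc (card (edges t))"
    and "oleaf (Node (children T @ [t])) = oleaf T + oleaf t"
    and "yleaf (Node (children T @ [t])) = yleaf T + yleaf t"
    by (simp_all add: T card_edges_Node oleaf_Node yleaf_Node)
qed

lemma last_child_tree_statistics:
  "card (edges (last_child_tree m)) = vertices m
   \<and> oleaf (last_child_tree m) = tips m \<and> yleaf (last_child_tree m) = blues m"
  by (induction m)
    (simp_all add: snoc_child children_last_child_tree last_child_tree_not_leaf
      card_edges_Node[of "[]"] card_edges_Node[of "[t]" for t] oleaf_Node yleaf_Node)

section \<open>Decomposition at the first child\<close>

text \<open>
  The new subtree hangs at level 2, so it contributes to the even-level statistics exactly as it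
  does on its own.  The second equation is a dummy: only trees with at least one edge are extended.
\<close>

fun add_grandchild :: "plane_tree \<Rightarrow> plane_tree \<Rightarrow> plane_tree" where
  "add_grandchild t (Node (Node us # ts)) = Node (Node (t # us) # ts)"
| "add_grandchild t (Node []) = Node []"

text \<open>
  The first child of the root is a leaf for \<open>Tip\<close> and \<open>Red\<close>; otherwise its own first child is a
  leaf for \<open>Blue\<close> and the root of a larger tree for \<open>Fork\<close>.
\<close>

primrec first_child_tree :: "motzkin \<Rightarrow> plane_tree" where
  "first_child_tree Tip = Node [Node []]"
| "first_child_tree (Red m) = Node (Node [] # children (first_child_tree m))"
| "first_child_tree (Blue m) = add_grandchild (Node []) (first_child_tree m)"
| "first_child_tree (Fork m m') = add_grandchild (first_child_tree m') (first_child_tree m)"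

lemma first_child_tree_shape: "\<exists>us ts. first_child_tree m = Node (Node us # ts)"
proof (induction m)
  case (Red m)
  then show ?case by auto
qed auto

lemma add_grandchild_inject:
  "add_grandchild t (first_child_tree m) = add_grandchild t' (first_child_tree m')
   \<longleftrightarrow> t = t' \<and> first_child_tree m = first_child_tree m'"
  using first_child_tree_shape[of m] first_child_tree_shape[of m'] by auto

lemma add_grandchild_neq:
  "add_grandchild t (first_child_tree m) \<noteq> Node (Node [] # ts)"
  using first_child_tree_shape[of m] by auto

lemma first_child_tree_not_leaf: "first_child_tree m \<noteq> Node []"
  using first_child_tree_shape[of m] by auto

lemma children_first_child_tree: "children (first_child_tree m) \<noteq> []"
  using first_child_tree_shape[of m] by auto

lemmas first_child_tree_neqs =
  first_child_tree_not_leaf children_first_child_tree add_grandchild_neq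
  first_child_tree_not_leaf[symmetric] children_first_child_tree[symmetric]
  add_grandchild_neq[symmetric]

lemma inj_first_child_tree: "inj first_child_tree"
proof (rule injI)
  have children_inj: "children T = children T' \<Longrightarrow> T = T'" for T T'
    by (cases T; cases T') auto
  fix m m' show "first_child_tree m = first_child_tree m' \<Longrightarrow> m = m'"
  proof (induction m arbitrary: m')
    case Tip
    then show ?case by (cases m') (auto simp: first_child_tree_neqs)
  next
    case (Red m)
    then show ?case by (cases m') (auto simp: first_child_tree_neqs intro: children_inj)
  next
    case (Blue m)
    then show ?case by (cases m') (auto simp: first_child_tree_neqs add_grandchild_inject)
  next
    case (Fork m1 m2)
    then show ?case by (cases m') (auto simp: first_child_tree_neqs add_grandchild_inject)
  qed
qed

lemma range_first_child_tree: "T \<noteq> Node [] \<Longrightarrow> T \<in> range first_child_tree"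
proof (induction "size T" arbitrary: T rule: less_induct)
  case less
  obtain us ts where T: "T = Node (Node us # ts)"
    using less.prems by (metis plane_tree.exhaust list.exhaust)
  show ?case
  proof (cases us)
    case Nil
    show ?thesis
    proof (cases "ts = []")
      case True
      with Nil have "T = first_child_tree Tip" by (simp add: T)
      then show ?thesis by blast
    next
      case False
      then have "Node ts \<in> range first_child_tree"
        using less.hyps[of "Node ts"] by (simp add: T)
      then obtain m where "first_child_tree m = Node ts" by (metis imageE)
      with Nil have "T = first_child_tree (Red m)" by (simp add: T)
      then show ?thesis by blast
    qed
  next
    case (Cons t us')
    have "Node (Node us' # ts) \<in> range first_child_tree"
      using less.hyps[of "Node (Node us' # ts)"] by (simp add: T Cons)
    then obtain m where m: "first_child_tree m = Node (Node us' # ts)" by (metis imageE)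
    show ?thesis
    proof (cases "t = Node []")
      case True
      with m Cons have "T = first_child_tree (Blue m)" by (simp add: T)
      then show ?thesis by blast
    next
      case False
      then have "t \<in> range first_child_tree"
        using less.hyps[of t] by (simp add: T Cons)
      then obtain m' where "first_child_tree m' = t" by blast
      with m Cons have "T = first_child_tree (Fork m m')" by (simp add: T)
      then show ?thesis by blast
    qed
  qed
qed

lemma add_grandchild_statistics:
  assumes "T = Node (Node us # ts)"
  shows "card (edges (add_grandchild t T)) = Suc (card (edges t) + card (edges T))"
    and "elint (add_grandchild t T) = elint t + elint T"
    and "elleaf (add_grandchild t T) = elleaf t + elleaf T"
  by (simp_all add: assms card_edges_Node elint_Node elleaf_Node olint_Node olleaf_Node)

text \<open>
  The new leaf lies at level 1, and the root stays an internal node, because it already had a child.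
\<close>

lemma cons_leaf_child:
  assumes "T = Node (u # us)"
  shows "card (edges (Node (Node [] # children T))) = Suc (card (edges T))"
    and "elint (Node (Node [] # children T)) = elint T"
    and "elleaf (Node (Node [] # children T)) = elleaf T"
  by (simp_all add: assms card_edges_Node elint_Node elleaf_Node olint_Node olleaf_Node)

lemma first_child_tree_statistics:
  "card (edges (first_child_tree m)) = vertices m
   \<and> elint (first_child_tree m) = tips m \<and> elleaf (first_child_tree m) = blues m"
proof (induction m)
  case Tip
  show ?case by (simp add: card_edges_Node elint_Node elleaf_Node olint_Node olleaf_Node)
next
  case (Red m)
  obtain u us where "first_child_tree m = Node (u # us)"
    using first_child_tree_shape by blast
  note cons_leaf_child[OF this]
  with Red show ?case by simp
next
  case (Blue m)
  obtain us ts where "first_child_tree m = Node (Node us # ts)"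
    using first_child_tree_shape by blast
  note add_grandchild_statistics[OF this, of "Node []"]
  with Blue show ?case
    by (simp add: card_edges_Node[of "[]"] elint_Node[of "[]"] elleaf_Node[of "[]"])
next
  case (Fork m m')
  obtain us ts where "first_child_tree m = Node (Node us # ts)"
    using first_child_tree_shape by blast
  note add_grandchild_statistics[OF this, of "first_child_tree m'"]
  with Fork show ?case by simp
qed

section \<open>Equidistribution\<close>

text \<open>
  The one-node tree may be missing from the range of \<open>f\<close>; it has no edges, so \<open>n \<ge> 1\<close> excludes it.
\<close>

lemma bij_betw_plane_trees:
  assumes "n \<ge> 1" and "inj f" and "\<And>T. T \<noteq> Node [] \<Longrightarrow> T \<in> range f"
    and edges: "\<And>m. card (edges (f m)) = vertices m"
  shows "bij_betw f {m. vertices m = n} (plane_trees n)"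
proof (rule bij_betw_imageI)
  show "inj_on f {m. vertices m = n}"
    using \<open>inj f\<close> by (rule inj_on_subset) simp
  have "T \<in> f ` {m. vertices m = n}" if "T \<in> plane_trees n" for T
  proof -
    have n: "card (edges T) = n" using that by (simp add: plane_trees_def)
    with \<open>n \<ge> 1\<close> have "T \<noteq> Node []" by (auto simp: card_edges_Node)
    then obtain m where "T = f m" using assms(3) by blast
    with n edges show ?thesis by auto
  qed
  then show "f ` {m. vertices m = n} = plane_trees n"
    using edges by (auto simp: plane_trees_def)
qed

theorem corollary2p18:
  fixes x y :: "'a :: comm_semiring_1" and n :: nat
  assumes "n \<ge> 1"
  shows "(\<Sum>T\<in>plane_trees n. x ^ oleaf T * y ^ yleaf T)
       = (\<Sum>T\<in>plane_trees n. x ^ elint T * y ^ elleaf T)"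
proof -
  have last: "bij_betw last_child_tree {m. vertices m = n} (plane_trees n)"
    using assms inj_last_child_tree range_last_child_tree last_child_tree_statistics
    by (intro bij_betw_plane_trees) auto
  have first: "bij_betw first_child_tree {m. vertices m = n} (plane_trees n)"
    using assms inj_first_child_tree range_first_child_tree first_child_tree_statistics
    by (intro bij_betw_plane_trees) auto
  have "(\<Sum>T\<in>plane_trees n. x ^ oleaf T * y ^ yleaf T)
      = (\<Sum>m | vertices m = n. x ^ tips m * y ^ blues m)"
    by (simp add: last_child_tree_statistics flip: sum.reindex_bij_betw[OF last])
  also have "\<dots> = (\<Sum>T\<in>plane_trees n. x ^ elint T * y ^ elleaf T)"
    by (simp add: first_child_tree_statistics flip: sum.reindex_bij_betw[OF first])
  finally show ?thesis .
qed

end
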